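(* Consider a multilayer network with nodes $i,j$, layers $s,r$, within-layer adjacency $\mathbf A=(A_{ijs})$ and between-layer adjacency $\mathbf C=(C_{isr})$. Let $\mathcal{M}(\upsilon)$ be the hard-partition multilayer edge mixture objective (defined in the context). Rearranged in terms of $\mathbf A$ and $\mathbf C$ it reads $$\begin{aligned}\mathcal{M}(\upsilon)=&\sum_{i,j,s}\Big[(a_{ijs}-b_{ijs}-c_{ijs}+d_{ijs})A_{ijs}\,\delta(\upsilon_{is},\upsilon_{js})+(b_{ijs}-d_{ijs})\,\delta(\upsilon_{is},\upsilon_{js})\Big]\\&+\sum_{i,s,r}\Big[(e_{isr}-f_{isr}-g_{isr}+h_{isr})C_{isr}\,\delta(\upsilon_{is},\upsilon_{ir})+(f_{isr}-h_{isr})\,\delta(\upsilon_{is},\upsilon_{ir})\Big]+\text{constant},\end{aligned}$$ where "constant" refers to the terms that are independent of the community assignment $\upsilon$. Consider an evaluator of community structure of the form $$E=\sum_{i,j,s}\big[k_1(\mathbf{x}_1)A_{ijs}+k_2(\mathbf{x}_2)\big]\delta(\upsilon_{is},\upsilon_{js})+\sum_{i,s,r}\big[k_3(\mathbf{x}_3)C_{isr}+k_4(\mathbf{x}_4)\big]\delta(\upsilon_{is},\upsilon_{ir}),$$ where each $k_x$ is an arbitrary function except for those taking the adjacency $\mathbf A$ and $\mathbf C$ directly as inputs. Comparing the corresponding coefficients in $E$ and in the rearranged $\mathcal{M}(\upsilon)$ gives $$a_{ijs}-c_{ijs}=k_1+k_2,\qquad b_{ijs}-d_{ijs}=k_2,\qquad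 e_{isr}-g_{isr}=k_3+k_4,\qquad f_{isr}-h_{isr}=k_4.$$ Since there are eight free hyper parameters and only these four equations, the decomposition of $E$ into the form of $\mathcal{M}$ is not unique.
   Context: All layers share the same node set; $A_{ijs}$ is the adjacency of nodes $i,j$ in layer $s$, and $C_{isr}$ is the coupling between the copies of node $i$ in layers $s$ and $r$. A community assignment $\upsilon$ gives each pair (node $i$, layer $s$) a label $\upsilon_{is}$; $\delta$ is the Kronecker delta. The hard-partition multilayer edge mixture (MEMM) objective, with hyper parameters $a_{ijs},b_{ijs},c_{ijs},d_{ijs},e_{isr},f_{isr},g_{isr},h_{isr}$ into which the signs (contribution types) of the eight terms have been absorbed, is $$\begin{aligned}\mathcal{M}(\upsilon)=&\sum_{i\neq j,\,s}\Big(a_{ijs}A_{ijs}\delta(\upsilon_{is},\upsilon_{js})+b_{ijs}(1-A_{ijs})\delta(\upsilon_{is},\upsilon_{js})\\&\qquad+c_{ijs}A_{ijs}[1-\delta(\upsilon_{is},\upsilon_{js})]+d_{ijs}(1-A_{ijs})[1-\delta(\upsilon_{is},\upsilon_{js})]\Big)\\&+\sum_{s\ne r,\,i}\Big(e_{isr}C_{isr}\delta(\upsilon_{is},\upsilon_{ir})+f_{isr}(1-C_{isr})\delta(\upsilon_{is},\upsilon_{ir})\\&\qquad+g_{isr}C_{isr}[1-\delta(\upsilon_{is},\upsilon_{ir})]+h_{isr}(1-C_{isr})[1-\delta(\upsilon_{is},\upsilon_{ir})]\Big).\end{aligned}$$ In the rearranged form and in $E$, the sums over $i,j,s$ and over $i,s,r$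 are understood, as in this definition, with $i\neq j$ and $s\neq r$. *)

theory Defs
  imports Complex_Main
begin

text \<open>
  Nodes and layers are the elements of two finite types \<open>'n\<close> and \<open>'l\<close>; community labels
  are the elements of an arbitrary type \<open>'c\<close>.
\<close>

type_synonym ('n, 'l) intra = "'n \<Rightarrow> 'n \<Rightarrow> 'l \<Rightarrow> real"
type_synonym ('n, 'l) inter = "'n \<Rightarrow> 'l \<Rightarrow> 'l \<Rightarrow> real"
type_synonym ('n, 'l, 'c) assignment = "'n \<Rightarrow> 'l \<Rightarrow> 'c"

definition kdelta :: "'c \<Rightarrow> 'c \<Rightarrow> real" where
  "kdelta u v = (if u = v then 1 else 0)"

definition intra_idx :: "('n \<times> 'n \<times> 'l) set" where
  "intra_idx = {(i, j, s). i \<noteq> j}"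

definition inter_idx :: "('n \<times> 'l \<times> 'l) set" where
  "inter_idx = {(i, s, r). s \<noteq> r}"

record ('n, 'l) hyper =
  hyp_a :: "('n, 'l) intra"
  hyp_b :: "('n, 'l) intra"
  hyp_c :: "('n, 'l) intra"
  hyp_d :: "('n, 'l) intra"
  hyp_e :: "('n, 'l) inter"
  hyp_f :: "('n, 'l) inter"
  hyp_g :: "('n, 'l) inter"
  hyp_h :: "('n, 'l) inter"

definition memm ::
  "('n::finite, 'l::finite) hyper \<Rightarrow> ('n, 'l) intra \<Rightarrow> ('n, 'l) inter
    \<Rightarrow> ('n, 'l, 'c) assignment \<Rightarrow> real" where
  "memm H A C \<upsilon> =
    (\<Sum>(i, j, s) \<in> intra_idx.
        hyp_a H i j s * A i j s * kdelta (\<upsilon> i s) (\<upsilon> j s)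
      + hyp_b H i j s * (1 - A i j s) * kdelta (\<upsilon> i s) (\<upsilon> j s)
      + hyp_c H i j s * A i j s * (1 - kdelta (\<upsilon> i s) (\<upsilon> j s))
      + hyp_d H i j s * (1 - A i j s) * (1 - kdelta (\<upsilon> i s) (\<upsilon> j s)))
  + (\<Sum>(i, s, r) \<in> inter_idx.
        hyp_e H i s r * C i s r * kdelta (\<upsilon> i s) (\<upsilon> i r)
      + hyp_f H i s r * (1 - C i s r) * kdelta (\<upsilon> i s) (\<upsilon> i r)
      + hyp_g H i s r * C i s r * (1 - kdelta (\<upsilon> i s) (\<upsilon> i r))
      + hyp_h H i s r * (1 - C i s r) * (1 - kdelta (\<upsilon> i s) (\<upsilon> i r)))"

text \<open>
  The coefficient functions \<open>k1, ..., k4\<close> are applied to inputs \<open>x1, ..., x4\<close> that may vary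
  with the index triple.  Neither receives \<open>A\<close> or \<open>C\<close>, which enter only as the explicit linear
  factors.  Inputs computed from one particular network, such as degrees, are covered by
  instantiating \<open>x1, ..., x4\<close> for that network.
\<close>

definition evaluator ::
  "('x1 \<Rightarrow> real) \<Rightarrow> ('n::finite \<Rightarrow> 'n \<Rightarrow> 'l::finite \<Rightarrow> 'x1)
    \<Rightarrow> ('x2 \<Rightarrow> real) \<Rightarrow> ('n \<Rightarrow> 'n \<Rightarrow> 'l \<Rightarrow> 'x2)
    \<Rightarrow> ('x3 \<Rightarrow> real) \<Rightarrow> ('n \<Rightarrow> 'l \<Rightarrow> 'l \<Rightarrow> 'x3)
    \<Rightarrow> ('x4 \<Rightarrow> real) \<Rightarrow> ('n \<Rightarrow> 'l \<Rightarrow> 'l \<Rightarrow> 'x4)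
    \<Rightarrow> ('n, 'l) intra \<Rightarrow> ('n, 'l) inter \<Rightarrow> ('n, 'l, 'c) assignment \<Rightarrow> real" where
  "evaluator k1 x1 k2 x2 k3 x3 k4 x4 A C \<upsilon> =
    (\<Sum>(i, j, s) \<in> intra_idx.
        (k1 (x1 i j s) * A i j s + k2 (x2 i j s)) * kdelta (\<upsilon> i s) (\<upsilon> j s))
  + (\<Sum>(i, s, r) \<in> inter_idx.
        (k3 (x3 i s r) * C i s r + k4 (x4 i s r)) * kdelta (\<upsilon> i s) (\<upsilon> i r))"

definition eq_up_to_constant :: "('v \<Rightarrow> real) \<Rightarrow> ('v \<Rightarrow> real) \<Rightarrow> bool" where
  "eq_up_to_constant F G \<longleftrightarrow> (\<exists>const. \<forall>\<upsilon>. F \<upsilon> = G \<upsilon> + const)"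

definition coefficient_equations ::
  "('n, 'l) hyper
    \<Rightarrow> ('x1 \<Rightarrow> real) \<Rightarrow> ('n \<Rightarrow> 'n \<Rightarrow> 'l \<Rightarrow> 'x1)
    \<Rightarrow> ('x2 \<Rightarrow> real) \<Rightarrow> ('n \<Rightarrow> 'n \<Rightarrow> 'l \<Rightarrow> 'x2)
    \<Rightarrow> ('x3 \<Rightarrow> real) \<Rightarrow> ('n \<Rightarrow> 'l \<Rightarrow> 'l \<Rightarrow> 'x3)
    \<Rightarrow> ('x4 \<Rightarrow> real) \<Rightarrow> ('n \<Rightarrow> 'l \<Rightarrow> 'l \<Rightarrow> 'x4) \<Rightarrow> bool" where
  "coefficient_equations H k1 x1 k2 x2 k3 x3 k4 x4 \<longleftrightarrow>
    (\<forall>(i, j, s) \<in> intra_idx.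
        hyp_a H i j s - hyp_c H i j s = k1 (x1 i j s) + k2 (x2 i j s)
      \<and> hyp_b H i j s - hyp_d H i j s = k2 (x2 i j s))
  \<and> (\<forall>(i, s, r) \<in> inter_idx.
        hyp_e H i s r - hyp_g H i s r = k3 (x3 i s r) + k4 (x4 i s r)
      \<and> hyp_f H i s r - hyp_h H i s r = k4 (x4 i s r))"

text \<open>
  Hyper parameters at the diagonal indices \<open>i = j\<close> and \<open>s = r\<close> do not occur in the objective,
  so two decompositions are identified when they differ only there.
\<close>

definition same_hyper :: "('n, 'l) hyper \<Rightarrow> ('n, 'l) hyper \<Rightarrow> bool" where
  "same_hyper H H' \<longleftrightarrow>
    (\<forall>(i, j, s) \<in> intra_idx.
        hyp_a H i j s = hyp_a H' i j s \<and> hyp_b H i j s = hyp_b H' i j s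
      \<and> hyp_c H i j s = hyp_c H' i j s \<and> hyp_d H i j s = hyp_d H' i j s)
  \<and> (\<forall>(i, s, r) \<in> inter_idx.
        hyp_e H i s r = hyp_e H' i s r \<and> hyp_f H i s r = hyp_f H' i s r
      \<and> hyp_g H i s r = hyp_g H' i s r \<and> hyp_h H i s r = hyp_h H' i s r)"

end

theory Submission
  imports Defs
begin

text \<open>Each summand of the objective is affine in its Kronecker delta. The slope is again
  affine in the adjacency and involves the hyper parameters only through the differences
  \<open>a - c\<close>, \<open>b - d\<close> (within layers) and \<open>e - g\<close>,
  \<open>f - h\<close> (between layers); the intercept does not depend on the assignment
  (\<open>memm_rearranged\<close>). Matching slopes with the evaluator therefore prescribes just
  these four differences at each off-diagonal index (\<open>coefficient_equations_iff\<close>), and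
  any match gives equality up to a constant (\<open>memm_eq_evaluator\<close>). Shifting both
  members of such a pair by the same amount changes only the intercept, so \<open>c\<close>,
  \<open>d\<close>, \<open>g\<close>, \<open>h\<close> can be chosen freely
  (\<open>ex_coefficient_equations\<close>), and two different choices give two
  decompositions.\<close>

lemma memm_rearranged:
  "memm H A C \<upsilon> =
      (\<Sum>(i, j, s) \<in> intra_idx.
          (hyp_a H i j s - hyp_b H i j s - hyp_c H i j s + hyp_d H i j s)
            * A i j s * kdelta (\<upsilon> i s) (\<upsilon> j s)
        + (hyp_b H i j s - hyp_d H i j s) * kdelta (\<upsilon> i s) (\<upsilon> j s))
    + (\<Sum>(i, s, r) \<in> inter_idx.
          (hyp_e H i s r - hyp_f H i s r - hyp_g H i s r + hyp_h H i s r)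
            * C i s r * kdelta (\<upsilon> i s) (\<upsilon> i r)
        + (hyp_f H i s r - hyp_h H i s r) * kdelta (\<upsilon> i s) (\<upsilon> i r))
    + ((\<Sum>(i, j, s) \<in> intra_idx. hyp_c H i j s * A i j s + hyp_d H i j s * (1 - A i j s))
      + (\<Sum>(i, s, r) \<in> inter_idx. hyp_g H i s r * C i s r + hyp_h H i s r * (1 - C i s r)))"
proof -
  \<comment> \<open>One identity serves both sums: \<open>w\<close> is the adjacency or coupling,
    \<open>t\<close> the delta. The last bracket is the value at \<open>t = 0\<close>, which goes
    into the constant.\<close>
  have term_eq: "p * w * t + q * (1 - w) * t + u * w * (1 - t) + v * (1 - w) * (1 - t)
      = ((p - q - u + v) * w * t + (q - v) * t) + (u * w + v * (1 - w))"
    for p q u v w t :: real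
    by (simp add: algebra_simps)
  show ?thesis
    unfolding memm_def term_eq
    by (simp add: case_prod_beta sum.distrib)
qed

lemma coefficient_equations_iff:
  "coefficient_equations H k1 x1 k2 x2 k3 x3 k4 x4 \<longleftrightarrow>
    (\<forall>(i, j, s) \<in> intra_idx.
        hyp_a H i j s - hyp_b H i j s - hyp_c H i j s + hyp_d H i j s = k1 (x1 i j s)
      \<and> hyp_b H i j s - hyp_d H i j s = k2 (x2 i j s))
  \<and> (\<forall>(i, s, r) \<in> inter_idx.
        hyp_e H i s r - hyp_f H i s r - hyp_g H i s r + hyp_h H i s r = k3 (x3 i s r)
      \<and> hyp_f H i s r - hyp_h H i s r = k4 (x4 i s r))"
proof -
  \<comment> \<open>The two systems differ by adding or subtracting the equation
    \<open>b - d = k'\<close>.\<close>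
  have eqs: "a - c = k + k' \<and> b - d = k' \<longleftrightarrow> a - b - c + d = k \<and> b - d = k'"
    for a b c d k k' :: real
    by auto
  show ?thesis
    unfolding coefficient_equations_def eqs ..
qed

lemma memm_eq_evaluator:
  assumes "coefficient_equations H k1 x1 k2 x2 k3 x3 k4 x4"
  shows "eq_up_to_constant (memm H A C) (evaluator k1 x1 k2 x2 k3 x3 k4 x4 A C)"
proof -
  have intra:
    "hyp_a H i j s - hyp_b H i j s - hyp_c H i j s + hyp_d H i j s = k1 (x1 i j s)"
    "hyp_b H i j s - hyp_d H i j s = k2 (x2 i j s)" if "(i, j, s) \<in> intra_idx" for i j s
    using assms that unfolding coefficient_equations_iff by auto
  have inter:
    "hyp_e H i s r - hyp_f H i s r - hyp_g H i s r + hyp_h H i s r = k3 (x3 i s r)"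
    "hyp_f H i s r - hyp_h H i s r = k4 (x4 i s r)" if "(i, s, r) \<in> inter_idx" for i s r
    using assms that unfolding coefficient_equations_iff by auto
  show ?thesis
    unfolding eq_up_to_constant_def memm_rearranged evaluator_def
    \<comment> \<open>Cancelling on the right instantiates the existential witness with the constant
      of \<open>memm_rearranged\<close>, which is legitimate because that term does not mention
      \<upsilon>. The two remaining sums agree termwise once the delta is factored out.\<close>
    by (rule exI, rule allI, rule add_right_cancel[THEN iffD2],
        rule arg_cong2[where f = "(+)"]; rule sum.cong)
      (auto simp: intra inter simp flip: distrib_right)
qed

text \<open>Once \<open>c\<close>, \<open>d\<close>, \<open>g\<close>, \<open>h\<close> are
  prescribed, the equations can be solved explicitly for \<open>a\<close>, \<open>b\<close>,
  \<open>e\<close>, \<open>f\<close>.\<close>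

lemma ex_coefficient_equations:
  "\<exists>H. hyp_c H = c \<and> hyp_d H = d \<and> hyp_g H = g \<and> hyp_h H = h
    \<and> coefficient_equations H k1 x1 k2 x2 k3 x3 k4 x4"
  by (rule exI[where x = "\<lparr>
        hyp_a = \<lambda>i j s. k1 (x1 i j s) + k2 (x2 i j s) + c i j s,
        hyp_b = \<lambda>i j s. k2 (x2 i j s) + d i j s,
        hyp_c = c, hyp_d = d,
        hyp_e = \<lambda>i s r. k3 (x3 i s r) + k4 (x4 i s r) + g i s r,
        hyp_f = \<lambda>i s r. k4 (x4 i s r) + h i s r,
        hyp_g = g, hyp_h = h\<rparr>"])
    (auto simp: coefficient_equations_def)

lemma ex_distinct_coefficient_equations:
  fixes x1 :: "'n::finite \<Rightarrow> 'n \<Rightarrow> 'l::finite \<Rightarrow> 'x1"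
  assumes "2 \<le> card (UNIV :: 'n set) \<or> 2 \<le> card (UNIV :: 'l set)"
  shows "\<exists>H H'. coefficient_equations H k1 x1 k2 x2 k3 x3 k4 x4
    \<and> coefficient_equations H' k1 x1 k2 x2 k3 x3 k4 x4 \<and> \<not> same_hyper H H'"
proof -
  \<comment> \<open>\<open>H\<close> and \<open>H'\<close> take the free parameters \<open>c\<close>
    and \<open>g\<close> to be constantly 0 and constantly 1, so they disagree at every index of
    either kind.\<close>
  obtain H where H: "hyp_c H = (\<lambda>_ _ _. 0)" "hyp_g H = (\<lambda>_ _ _. 0)"
    "coefficient_equations H k1 x1 k2 x2 k3 x3 k4 x4"
    using ex_coefficient_equations by blast
  obtain H' where H': "hyp_c H' = (\<lambda>_ _ _. 1)" "hyp_g H' = (\<lambda>_ _ _. 1)"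
    "coefficient_equations H' k1 x1 k2 x2 k3 x3 k4 x4"
    using ex_coefficient_equations by blast
  \<comment> \<open>Since types are nonempty, two distinct nodes or two distinct layers already
    yield a triple in \<open>intra_idx\<close> or \<open>inter_idx\<close>, where
    \<open>same_hyper\<close> fails.\<close>
  have "(\<exists>i j :: 'n. i \<noteq> j) \<or> (\<exists>s r :: 'l. s \<noteq> r)"
    using assms card_le_Suc0_iff_eq[of "UNIV :: 'n set"] card_le_Suc0_iff_eq[of "UNIV :: 'l set"]
    by force
  then have "\<not> same_hyper H H'"
    using H H' by (auto simp: same_hyper_def intra_idx_def inter_idx_def)
  with H(3) H'(3) show ?thesis by blast
qed

theorem mainTheorem3:
  fixes k1 :: "'x1 \<Rightarrow> real" and x1 :: "'n::finite \<Rightarrow> 'n \<Rightarrow> 'l::finite \<Rightarrow> 'x1"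
    and k2 :: "'x2 \<Rightarrow> real" and x2 :: "'n \<Rightarrow> 'n \<Rightarrow> 'l \<Rightarrow> 'x2"
    and k3 :: "'x3 \<Rightarrow> real" and x3 :: "'n \<Rightarrow> 'l \<Rightarrow> 'l \<Rightarrow> 'x3"
    and k4 :: "'x4 \<Rightarrow> real" and x4 :: "'n \<Rightarrow> 'l \<Rightarrow> 'l \<Rightarrow> 'x4"
  shows
    \<comment> \<open>the rearranged form\<close>
    "(\<forall>(H :: ('n, 'l) hyper) A C. \<exists>const. \<forall>\<upsilon> :: ('n, 'l, 'c) assignment.
        memm H A C \<upsilon> =
          (\<Sum>(i, j, s) \<in> intra_idx.
              (hyp_a H i j s - hyp_b H i j s - hyp_c H i j s + hyp_d H i j s)
                * A i j s * kdelta (\<upsilon> i s) (\<upsilon> j s)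
            + (hyp_b H i j s - hyp_d H i j s) * kdelta (\<upsilon> i s) (\<upsilon> j s))
        + (\<Sum>(i, s, r) \<in> inter_idx.
              (hyp_e H i s r - hyp_f H i s r - hyp_g H i s r + hyp_h H i s r)
                * C i s r * kdelta (\<upsilon> i s) (\<upsilon> i r)
            + (hyp_f H i s r - hyp_h H i s r) * kdelta (\<upsilon> i s) (\<upsilon> i r))
        + const)
    \<comment> \<open>comparing its coefficients with those of the evaluator\<close>
    \<and> (\<forall>H :: ('n, 'l) hyper.
        ((\<forall>(i, j, s) \<in> intra_idx.
             hyp_a H i j s - hyp_b H i j s - hyp_c H i j s + hyp_d H i j s = k1 (x1 i j s)
           \<and> hyp_b H i j s - hyp_d H i j s = k2 (x2 i j s))
         \<and> (\<forall>(i, s, r) \<in> inter_idx.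
             hyp_e H i s r - hyp_f H i s r - hyp_g H i s r + hyp_h H i s r = k3 (x3 i s r)
           \<and> hyp_f H i s r - hyp_h H i s r = k4 (x4 i s r)))
        \<longleftrightarrow> coefficient_equations H k1 x1 k2 x2 k3 x3 k4 x4)
    \<comment> \<open>any solution is a decomposition of the evaluator\<close>
    \<and> (\<forall>H :: ('n, 'l) hyper. coefficient_equations H k1 x1 k2 x2 k3 x3 k4 x4 \<longrightarrow>
        (\<forall>A C. eq_up_to_constant
          (memm H A C :: ('n, 'l, 'c) assignment \<Rightarrow> real)
          (evaluator k1 x1 k2 x2 k3 x3 k4 x4 A C)))
    \<comment> \<open>four of the eight hyper parameters remain free\<close>
    \<and> (\<forall>(c :: ('n, 'l) intra) (d :: ('n, 'l) intra) (g :: ('n, 'l) inter) (h :: ('n, 'l) inter).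
        \<exists>H. hyp_c H = c \<and> hyp_d H = d \<and> hyp_g H = g \<and> hyp_h H = h
          \<and> coefficient_equations H k1 x1 k2 x2 k3 x3 k4 x4)
    \<comment> \<open>the decomposition is not unique, as soon as the objective has at least one term\<close>
    \<and> (2 \<le> card (UNIV :: 'n set) \<or> 2 \<le> card (UNIV :: 'l set) \<longrightarrow>
        (\<exists>H H' :: ('n, 'l) hyper.
            coefficient_equations H k1 x1 k2 x2 k3 x3 k4 x4
          \<and> coefficient_equations H' k1 x1 k2 x2 k3 x3 k4 x4
          \<and> (\<forall>A C. eq_up_to_constant
              (memm H A C :: ('n, 'l, 'c) assignment \<Rightarrow> real)
              (evaluator k1 x1 k2 x2 k3 x3 k4 x4 A C))
          \<and> (\<forall>A C. eq_up_to_constant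
              (memm H' A C :: ('n, 'l, 'c) assignment \<Rightarrow> real)
              (evaluator k1 x1 k2 x2 k3 x3 k4 x4 A C))
          \<and> \<not> same_hyper H H'))"
proof (intro conjI allI impI)
  show "\<exists>const. \<forall>\<upsilon> :: ('n, 'l, 'c) assignment. memm H A C \<upsilon> =
          (\<Sum>(i, j, s) \<in> intra_idx.
              (hyp_a H i j s - hyp_b H i j s - hyp_c H i j s + hyp_d H i j s)
                * A i j s * kdelta (\<upsilon> i s) (\<upsilon> j s)
            + (hyp_b H i j s - hyp_d H i j s) * kdelta (\<upsilon> i s) (\<upsilon> j s))
        + (\<Sum>(i, s, r) \<in> inter_idx.
              (hyp_e H i s r - hyp_f H i s r - hyp_g H i s r + hyp_h H i s r)
                * C i s r * kdelta (\<upsilon> i s) (\<upsilon> i r)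
            + (hyp_f H i s r - hyp_h H i s r) * kdelta (\<upsilon> i s) (\<upsilon> i r))
        + const" for H :: "('n, 'l) hyper" and A C
    by (intro exI allI) (rule memm_rearranged)
next
  fix H :: "('n, 'l) hyper"
  show "((\<forall>(i, j, s) \<in> intra_idx.
             hyp_a H i j s - hyp_b H i j s - hyp_c H i j s + hyp_d H i j s = k1 (x1 i j s)
           \<and> hyp_b H i j s - hyp_d H i j s = k2 (x2 i j s))
         \<and> (\<forall>(i, s, r) \<in> inter_idx.
             hyp_e H i s r - hyp_f H i s r - hyp_g H i s r + hyp_h H i s r = k3 (x3 i s r)
           \<and> hyp_f H i s r - hyp_h H i s r = k4 (x4 i s r)))
        \<longleftrightarrow> coefficient_equations H k1 x1 k2 x2 k3 x3 k4 x4"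
    by (rule coefficient_equations_iff[symmetric])
next
  fix H :: "('n, 'l) hyper" and A C
  assume "coefficient_equations H k1 x1 k2 x2 k3 x3 k4 x4"
  then show "eq_up_to_constant (memm H A C :: ('n, 'l, 'c) assignment \<Rightarrow> real)
      (evaluator k1 x1 k2 x2 k3 x3 k4 x4 A C)"
    by (rule memm_eq_evaluator)
next
  fix c d :: "('n, 'l) intra" and g h :: "('n, 'l) inter"
  show "\<exists>H. hyp_c H = c \<and> hyp_d H = d \<and> hyp_g H = g \<and> hyp_h H = h
      \<and> coefficient_equations H k1 x1 k2 x2 k3 x3 k4 x4"
    by (rule ex_coefficient_equations)
next
  assume "2 \<le> card (UNIV :: 'n set) \<or> 2 \<le> card (UNIV :: 'l set)"
  then obtain H H' where
    "coefficient_equations H k1 x1 k2 x2 k3 x3 k4 x4"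
    "coefficient_equations H' k1 x1 k2 x2 k3 x3 k4 x4"
    "\<not> same_hyper H H'"
    using ex_distinct_coefficient_equations by blast
  then show "\<exists>H H' :: ('n, 'l) hyper.
            coefficient_equations H k1 x1 k2 x2 k3 x3 k4 x4
          \<and> coefficient_equations H' k1 x1 k2 x2 k3 x3 k4 x4
          \<and> (\<forall>A C. eq_up_to_constant
              (memm H A C :: ('n, 'l, 'c) assignment \<Rightarrow> real)
              (evaluator k1 x1 k2 x2 k3 x3 k4 x4 A C))
          \<and> (\<forall>A C. eq_up_to_constant
              (memm H' A C :: ('n, 'l, 'c) assignment \<Rightarrow> real)
              (evaluator k1 x1 k2 x2 k3 x3 k4 x4 A C))
          \<and> \<not> same_hyper H H'"
    by (intro exI conjI allI memm_eq_evaluator)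
qed

end
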